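(* Let $\{X,\phi_i\}$ be a fundamental limit space for the stationary closed injective system $\{X_i,Y_i,f_i\}$, in which each $X_i$ has the finite-perfect property $\mathfrak{P}$. Then $X$ has $\mathfrak{P}$.
   Context: $\mathbb{N}=\{0,1,2,\dots\}$. A closed injective system (CIS) $\{X_i,Y_i,f_i\}$ consists, for each $i\in\mathbb{N}$, of a nonempty topological space $X_i$, a closed subspace $Y_i\subset X_i$ and a closed injective continuous map $f_i:Y_i\to X_{i+1}$. It is stationary if there is a nonnegative integer $n_0$ such that, for all $n\ge n_0$, $Y_n=Y_{n_0}=X_{n_0}=X_n$ and $f_n$ is the identity map. Semicomponibility. Each $f_i$ is semicomponible with itself; put $Y_{i,i}=Y_i$, $f_{i,i}=f_i$. For $j>i$, inductively, $f_i$ and $f_j$ are semicomponible if $f_i$ and $f_{j-1}$ are semicomponible and $f_{i,j-1}(Y_{i,j-1})\cap Y_j\neq\emptyset$; in that case $Y_{i,j}=f_{i,j-1}^{-1}(Y_j)$ and $f_{i,j}:Y_{i,j}\to X_{j+1}$ is $f_{i,j}(y)=f_j(f_{i,j-1}(y))$. A limit space for the CIS is a topological space $X$ with continuous maps $\phi_i:X_i\to X$ ($i\in\mathbb{N}$) such that: (1) $X=\bigcup_{i}\phi_i(X_i)$; (2) each $\phi_i$ is an embedding (a homeomorphism onto its image); (3) if $i<j$ and $f_i$, $f_{j-1}$ are semicomponible, then $\phi_i(X_i)\cap\phi_j(X_j)=\phi_j(f_{i,j-1}(Y_{i,j-1}))$, and whenever $\phi_i(x_i)=\phi_j(x_j)$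 with $x_i\in X_i$, $x_j\in X_j$, one has $x_i\in Y_{i,j-1}$ and $x_j=f_{i,j-1}(x_i)$; (4) if $i<j$ and $f_i$, $f_{j-1}$ are not semicomponible, then $\phi_i(X_i)\cap\phi_j(X_j)=\emptyset$. A fundamental limit space is a limit space $\{X,\phi_i\}$ such that $X$ has the weak topology: a subset $A\subset X$ is closed in $X$ if and only if $\phi_i^{-1}(A)$ is closed in $X_i$ for all $i\in\mathbb{N}$. A continuous map $f:Z\to W$ is perfect if it is closed, surjective, and $f^{-1}(w)$ is compact for each $w\in W$. A property $\mathfrak{P}$ of topological spaces is perfect if whenever $\mathfrak{P}$ holds for $Z$ and there is a perfect map $Z\to W$, then $\mathfrak{P}$ holds for $W$. It is finite-perfect if it is perfect and whenever $\mathfrak{P}$ holds for each member of a finite collection $\{Z_n\}_{n=0}^{n_0}$ of spaces, it holds for the coproduct (topological sum) $\coprod_{n=0}^{n_0}Z_n$. *)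

theory Defs
  imports "HOL-Analysis.Analysis"
begin

text \<open>
  The maps \<open>f i\<close> are total functions of the ambient type; only their values on
  \<open>Y i\<close> are meaningful.  The set \<open>Y i\<close> may be empty, \<open>X i\<close> may not.
\<close>

definition closed_injective_system ::
    "(nat \<Rightarrow> 'a topology) \<Rightarrow> (nat \<Rightarrow> 'a set) \<Rightarrow> (nat \<Rightarrow> 'a \<Rightarrow> 'a) \<Rightarrow> bool" where
  "closed_injective_system X Y f \<longleftrightarrow>
    (\<forall>i. topspace (X i) \<noteq> {} \<and>
         closedin (X i) (Y i) \<and>
         continuous_map (subtopology (X i) (Y i)) (X (Suc i)) (f i) \<and>
         closed_map (subtopology (X i) (Y i)) (X (Suc i)) (f i) \<and>
         inj_on (f i) (Y i))"

definition stationary_system ::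
    "(nat \<Rightarrow> 'a topology) \<Rightarrow> (nat \<Rightarrow> 'a set) \<Rightarrow> (nat \<Rightarrow> 'a \<Rightarrow> 'a) \<Rightarrow> bool" where
  "stationary_system X Y f \<longleftrightarrow>
    (\<exists>n0. \<forall>n\<ge>n0. Y n = Y n0 \<and> Y n0 = topspace (X n0) \<and> X n = X n0 \<and>
                 (\<forall>y\<in>Y n. f n y = y))"

text \<open>
  \<open>comp_map f i j\<close> and \<open>comp_dom Y f i j\<close> are $f_{i,j}$ and $Y_{i,j}$.  They are used
  only for \<open>i \<le> j\<close> and \<open>semicomponible Y f i j\<close>; all other values are irrelevant.
\<close>

primrec comp_map :: "(nat \<Rightarrow> 'a \<Rightarrow> 'a) \<Rightarrow> nat \<Rightarrow> nat \<Rightarrow> 'a \<Rightarrow> 'a" where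
  "comp_map f i 0 = f i"
| "comp_map f i (Suc j) =
    (if Suc j \<le> i then f i else (\<lambda>y. f (Suc j) (comp_map f i j y)))"

primrec comp_dom ::
    "(nat \<Rightarrow> 'a set) \<Rightarrow> (nat \<Rightarrow> 'a \<Rightarrow> 'a) \<Rightarrow> nat \<Rightarrow> nat \<Rightarrow> 'a set" where
  "comp_dom Y f i 0 = Y i"
| "comp_dom Y f i (Suc j) =
    (if Suc j \<le> i then Y i
     else {y \<in> comp_dom Y f i j. comp_map f i j y \<in> Y (Suc j)})"

inductive semicomponible ::
    "(nat \<Rightarrow> 'a set) \<Rightarrow> (nat \<Rightarrow> 'a \<Rightarrow> 'a) \<Rightarrow> nat \<Rightarrow> nat \<Rightarrow> bool"
  for Y f where
  refl: "semicomponible Y f i i"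
| step: "\<lbrakk>semicomponible Y f i j; comp_map f i j ` comp_dom Y f i j \<inter> Y (Suc j) \<noteq> {}\<rbrakk>
         \<Longrightarrow> semicomponible Y f i (Suc j)"

definition limit_space ::
    "(nat \<Rightarrow> 'a topology) \<Rightarrow> (nat \<Rightarrow> 'a set) \<Rightarrow> (nat \<Rightarrow> 'a \<Rightarrow> 'a) \<Rightarrow>
     'b topology \<Rightarrow> (nat \<Rightarrow> 'a \<Rightarrow> 'b) \<Rightarrow> bool" where
  "limit_space X Y f L \<phi> \<longleftrightarrow>
    (\<forall>i. continuous_map (X i) L (\<phi> i)) \<and>
    topspace L = (\<Union>i. \<phi> i ` topspace (X i)) \<and>
    (\<forall>i. embedding_map (X i) L (\<phi> i)) \<and>
    (\<forall>i j. i < j \<and> semicomponible Y f i (j - 1) \<longrightarrow>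
       \<phi> i ` topspace (X i) \<inter> \<phi> j ` topspace (X j)
         = \<phi> j ` (comp_map f i (j - 1) ` comp_dom Y f i (j - 1)) \<and>
       (\<forall>x\<in>topspace (X i). \<forall>x'\<in>topspace (X j). \<phi> i x = \<phi> j x' \<longrightarrow>
          x \<in> comp_dom Y f i (j - 1) \<and> x' = comp_map f i (j - 1) x)) \<and>
    (\<forall>i j. i < j \<and> \<not> semicomponible Y f i (j - 1) \<longrightarrow>
       \<phi> i ` topspace (X i) \<inter> \<phi> j ` topspace (X j) = {})"

definition fundamental_limit_space ::
    "(nat \<Rightarrow> 'a topology) \<Rightarrow> (nat \<Rightarrow> 'a set) \<Rightarrow> (nat \<Rightarrow> 'a \<Rightarrow> 'a) \<Rightarrow>
     'b topology \<Rightarrow> (nat \<Rightarrow> 'a \<Rightarrow> 'b) \<Rightarrow> bool" where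
  "fundamental_limit_space X Y f L \<phi> \<longleftrightarrow>
    limit_space X Y f L \<phi> \<and>
    (\<forall>A\<subseteq>topspace L.
       closedin L A \<longleftrightarrow> (\<forall>i. closedin (X i) {x \<in> topspace (X i). \<phi> i x \<in> A}))"

text \<open>
  A property of topological spaces is a predicate on the spaces carried by subsets of one
  type \<open>'a\<close>, which plays the role of the universe.  A coproduct of such spaces has underlying
  type \<open>nat \<times> 'a\<close>, so the property is asked of every space over \<open>'a\<close> that is a coproduct up
  to homeomorphism (a perfect property is invariant under homeomorphism).  These definitions
  say what they should only if the universe has room for finite coproducts, i.e. if \<open>'a\<close> is
  infinite.
\<close>

definition perfect_property :: "('a topology \<Rightarrow> bool) \<Rightarrow> bool" where
  "perfect_property P \<longleftrightarrow> (\<forall>Z W g. P Z \<and> perfect_map Z W g \<longrightarrow> P W)"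

definition finite_perfect_property :: "('a topology \<Rightarrow> bool) \<Rightarrow> bool" where
  "finite_perfect_property P \<longleftrightarrow>
    perfect_property P \<and>
    (\<forall>(n0::nat) Z W. (\<forall>n\<le>n0. P (Z n)) \<and> W homeomorphic_space sum_topology Z {0..n0} \<longrightarrow> P W)"

end

theory Submission
  imports Defs
begin

text \<open>
  Beyond the stage \<open>n0\<close> from which the system is constant, every \<open>\<phi> n\<close> coincides with
  \<open>\<phi> n0\<close>, so \<open>L\<close> is covered by the images of \<open>X 0, \<dots>, X n0\<close>.  Each \<open>\<phi> i\<close> is a closed
  map, because its intersection pattern with \<open>\<phi> j\<close> is governed by the closed injections
  \<open>comp_map f i (j - 1)\<close> and \<open>L\<close> has the weak topology.  Hence the obvious map from the finite
  coproduct onto \<open>L\<close> is closed with finite fibres, that is, perfect.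
\<close>

section \<open>Iterated maps of the system\<close>

lemma comp_map_diag [simp]: "comp_map f i i = f i"
  by (cases i) auto

lemma comp_dom_diag [simp]: "comp_dom Y f i i = Y i"
  by (cases i) auto

text \<open>Passing from \<open>j\<close> to \<open>Suc j\<close> cuts the domain down to the
  preimage of the closed set \<open>Y (Suc j)\<close> and then composes with
  \<open>f (Suc j)\<close>; all four properties survive both operations.\<close>

lemma comp_map_dom_closed_injection:
  assumes "closed_injective_system X Y f" "i \<le> j"
  shows "closedin (X i) (comp_dom Y f i j) \<and>
         continuous_map (subtopology (X i) (comp_dom Y f i j)) (X (Suc j)) (comp_map f i j) \<and>
         closed_map (subtopology (X i) (comp_dom Y f i j)) (X (Suc j)) (comp_map f i j) \<and>
         inj_on (comp_map f i j) (comp_dom Y f i j)"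
  using assms(2)
proof (induction j rule: dec_induct)
  case base
  then show ?case using assms(1) by (simp add: closed_injective_system_def)
next
  case (step j)
  let ?D = "comp_dom Y f i j" and ?D' = "comp_dom Y f i (Suc j)"
  let ?c = "comp_map f i j" and ?c' = "comp_map f i (Suc j)"
  have D': "?D' = {y \<in> ?D. ?c y \<in> Y (Suc j)}" and c': "?c' = f (Suc j) \<circ> ?c"
    using step.hyps by auto
  have Yc: "closedin (X (Suc j)) (Y (Suc j))"
    and f_cont: "continuous_map (subtopology (X (Suc j)) (Y (Suc j))) (X (Suc (Suc j))) (f (Suc j))"
    and f_closed: "closed_map (subtopology (X (Suc j)) (Y (Suc j))) (X (Suc (Suc j))) (f (Suc j))"
    and f_inj: "inj_on (f (Suc j)) (Y (Suc j))"
    using assms(1) by (auto simp: closed_injective_system_def)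
  have D: "closedin (X i) ?D" and c_cont: "continuous_map (subtopology (X i) ?D) (X (Suc j)) ?c"
    and c_closed: "closed_map (subtopology (X i) ?D) (X (Suc j)) ?c" and c_inj: "inj_on ?c ?D"
    using step.IH by auto
  have "closedin (subtopology (X i) ?D) {x \<in> topspace (subtopology (X i) ?D). ?c x \<in> Y (Suc j)}"
    using c_cont Yc closedin_continuous_map_preimage by blast
  moreover have "{x \<in> topspace (subtopology (X i) ?D). ?c x \<in> Y (Suc j)} = ?D'"
    using closedin_subset[OF D] D' by auto
  ultimately have D'closed: "closedin (X i) ?D'"
    using D closedin_trans_full by fastforce
  have sub: "subtopology (subtopology (X i) ?D) ?D' = subtopology (X i) ?D'"
    using D' by (metis (no_types, lifting) inf.absorb2 mem_Collect_eq subsetI subtopology_subtopology)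
  have cc: "continuous_map (subtopology (X i) ?D') (subtopology (X (Suc j)) (Y (Suc j))) ?c"
    using continuous_map_from_subtopology[OF c_cont, of ?D'] sub D'
    by (auto simp: continuous_map_in_subtopology)
  \<comment> \<open>Composing with \<open>f (Suc j)\<close> needs \<open>?c\<close> to be closed
    into \<open>Y (Suc j)\<close>. As \<open>?D'\<close> is closed in \<open>X i\<close>, its closed
    subsets are closed in \<open>?D\<close>, where the induction hypothesis applies.\<close>
  have "closed_map (subtopology (X i) ?D') (subtopology (X (Suc j)) (Y (Suc j))) ?c"
    unfolding closed_map_def
  proof (intro allI impI)
    fix C assume "closedin (subtopology (X i) ?D') C"
    then have C: "closedin (X i) C" "C \<subseteq> ?D'"
      using D'closed closedin_closed_subtopology by blast+
    then have "closedin (subtopology (X i) ?D) C"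
      using D D' closedin_closed_subtopology by blast
    then have "closedin (X (Suc j)) (?c ` C)"
      using c_closed by (simp add: closed_map_def)
    then show "closedin (subtopology (X (Suc j)) (Y (Suc j))) (?c ` C)"
      using C(2) D' Yc by (auto simp: closedin_closed_subtopology)
  qed
  moreover have "inj_on ?c' ?D'"
    unfolding c' using c_inj f_inj D' by (auto simp: inj_on_def)
  ultimately show ?case
    using D'closed cc f_cont f_closed continuous_map_compose closed_map_compose c' by metis
qed

text \<open>A point of the last domain survives every stage, so its images witness each nonempty
  intersection. The contrapositive serves later: without semicomponibility the domain is
  empty.\<close>

lemma comp_dom_nonempty_semicomponible:
  assumes "i \<le> j" "comp_dom Y f i j \<noteq> {}"
  shows "semicomponible Y f i j"
  using assms
proof (induction j rule: dec_induct)
  case base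
  then show ?case by (simp add: semicomponible.refl)
next
  case (step j)
  then show ?case by (intro semicomponible.step) auto
qed

section \<open>Identifications and closed sets in the limit space\<close>

lemma limit_space_maps_inj:
  assumes "limit_space X Y f L \<phi>"
  shows "inj_on (\<phi> i) (topspace (X i))"
  using assms by (simp add: limit_space_def embedding_map_def homeomorphic_eq_everything_map)

text \<open>Merges conditions (3) and (4) of a limit space into one pointwise criterion; in case (4)
  both sides are false because \<open>comp_dom Y f i k\<close> is empty.\<close>

lemma limit_space_eq_iff:
  assumes cis: "closed_injective_system X Y f" and lim: "limit_space X Y f L \<phi>"
    and ij: "i \<le> k" and x: "x \<in> topspace (X i)" and x': "x' \<in> topspace (X (Suc k))"
  shows "\<phi> i x = \<phi> (Suc k) x' \<longleftrightarrow> x \<in> comp_dom Y f i k \<and> x' = comp_map f i k x"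
proof (cases "semicomponible Y f i k")
  case True
  have "\<forall>i j. i < j \<and> semicomponible Y f i (j - 1) \<longrightarrow>
       \<phi> i ` topspace (X i) \<inter> \<phi> j ` topspace (X j)
         = \<phi> j ` (comp_map f i (j - 1) ` comp_dom Y f i (j - 1)) \<and>
       (\<forall>x\<in>topspace (X i). \<forall>x'\<in>topspace (X j). \<phi> i x = \<phi> j x' \<longrightarrow>
          x \<in> comp_dom Y f i (j - 1) \<and> x' = comp_map f i (j - 1) x)"
    using lim unfolding limit_space_def by (elim conjE)
  from this[rule_format, of i "Suc k"] True ij
  have *: "\<phi> i ` topspace (X i) \<inter> \<phi> (Suc k) ` topspace (X (Suc k))
             = \<phi> (Suc k) ` (comp_map f i k ` comp_dom Y f i k)"
    and **: "\<And>y y'. \<lbrakk>y \<in> topspace (X i); y' \<in> topspace (X (Suc k)); \<phi> i y = \<phi> (Suc k) y'\<rbrakk>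
               \<Longrightarrow> y \<in> comp_dom Y f i k \<and> y' = comp_map f i k y"
    by simp_all
  have "\<phi> i x = \<phi> (Suc k) x'" if xd: "x \<in> comp_dom Y f i k" and eq: "x' = comp_map f i k x"
  proof -
    have "\<phi> (Suc k) x' \<in> \<phi> i ` topspace (X i)"
      using * xd eq by blast
    \<comment> \<open>The equality of sets in (3) yields only some preimage \<open>y\<close>;
      injectivity of \<open>comp_map f i k\<close> identifies it with \<open>x\<close>.\<close>
    then obtain y where y: "y \<in> topspace (X i)" "\<phi> i y = \<phi> (Suc k) x'"
      by force
    then have "y \<in> comp_dom Y f i k" "comp_map f i k y = comp_map f i k x"
      using **[OF y(1) x' y(2)] eq by auto
    then have "y = x"
      using comp_map_dom_closed_injection[OF cis ij] xd by (auto dest: inj_onD)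
    with y show ?thesis by simp
  qed
  then show ?thesis using **[OF x x'] by blast
next
  case False
  have "\<forall>i j. i < j \<and> \<not> semicomponible Y f i (j - 1) \<longrightarrow>
       \<phi> i ` topspace (X i) \<inter> \<phi> j ` topspace (X j) = {}"
    using lim unfolding limit_space_def by (elim conjE)
  from this[rule_format, of i "Suc k"] False ij
  have "\<phi> i ` topspace (X i) \<inter> \<phi> (Suc k) ` topspace (X (Suc k)) = {}"
    by simp
  then have "\<phi> i x \<noteq> \<phi> (Suc k) x'"
    using x x' by (metis IntI empty_iff imageI)
  moreover have "comp_dom Y f i k = {}"
    using False ij comp_dom_nonempty_semicomponible by metis
  ultimately show ?thesis by simp
qed

lemma fundamental_limit_space_closed_map:
  assumes cis: "closed_injective_system X Y f" and fund: "fundamental_limit_space X Y f L \<phi>"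
  shows "closed_map (X i) L (\<phi> i)"
  unfolding closed_map_def
proof (intro allI impI)
  fix C assume C: "closedin (X i) C"
  have lim: "limit_space X Y f L \<phi>"
    using fund by (simp add: fundamental_limit_space_def)
  have Csub: "C \<subseteq> topspace (X i)"
    using C by (rule closedin_subset)
  have "closedin (X j) {x \<in> topspace (X j). \<phi> j x \<in> \<phi> i ` C}" for j
  proof (cases j i rule: linorder_cases)
    case equal
    then have "{x \<in> topspace (X j). \<phi> j x \<in> \<phi> i ` C} = C"
      using Csub limit_space_maps_inj[OF lim, of i] by (auto dest: inj_onD)
    with C equal show ?thesis by simp
  next
    case greater
    then obtain k where k: "j = Suc k" "i \<le> k"
      by (cases j) auto
    let ?D = "comp_dom Y f i k"
    have clo: "closed_map (subtopology (X i) ?D) (X j) (comp_map f i k)"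
      and cont: "continuous_map (subtopology (X i) ?D) (X j) (comp_map f i k)"
      using comp_map_dom_closed_injection[OF cis k(2)] k(1) by auto
    have im: "comp_map f i k x \<in> topspace (X j)" if "x \<in> C" "x \<in> ?D" for x
      using cont that Csub by (auto simp: continuous_map_def Pi_iff)
    \<comment> \<open>For \<open>i < j\<close> points of \<open>C\<close> are pushed forward to
      \<open>X j\<close>.\<close>
    have "{x \<in> topspace (X j). \<phi> j x \<in> \<phi> i ` C} = comp_map f i k ` (C \<inter> ?D)"
    proof (intro set_eqI iffI)
      fix x assume "x \<in> {x \<in> topspace (X j). \<phi> j x \<in> \<phi> i ` C}"
      then obtain c where "x \<in> topspace (X j)" "c \<in> C" "\<phi> i c = \<phi> j x"
        by force
      then show "x \<in> comp_map f i k ` (C \<inter> ?D)"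
        using limit_space_eq_iff[OF cis lim k(2), of c x] Csub k(1) by auto
    next
      fix x assume "x \<in> comp_map f i k ` (C \<inter> ?D)"
      then obtain c where c: "c \<in> C" "c \<in> ?D" "x = comp_map f i k c"
        by blast
      then have "\<phi> i c = \<phi> j x"
        using limit_space_eq_iff[OF cis lim k(2), of c x] Csub k(1) im by blast
      with c show "x \<in> {x \<in> topspace (X j). \<phi> j x \<in> \<phi> i ` C}"
        using im by (metis (no_types, lifting) imageI mem_Collect_eq)
    qed
    moreover have "closedin (subtopology (X i) ?D) (C \<inter> ?D)"
      using C closedin_subtopology by blast
    ultimately show ?thesis
      using clo by (simp add: closed_map_def)
  next
    case less
    then obtain k where k: "i = Suc k" "j \<le> k"
      by (cases i) auto
    let ?D = "comp_dom Y f j k"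
    have D: "closedin (X j) ?D"
      and cont: "continuous_map (subtopology (X j) ?D) (X i) (comp_map f j k)"
      using comp_map_dom_closed_injection[OF cis k(2)] k(1) by auto
    \<comment> \<open>For \<open>j < i\<close> the set \<open>C\<close> is pulled back to
      \<open>X j\<close>; closedness of \<open>?D\<close> then lifts the result from
      \<open>?D\<close> to \<open>X j\<close>.\<close>
    have "{x \<in> topspace (X j). \<phi> j x \<in> \<phi> i ` C}
          = {x \<in> topspace (subtopology (X j) ?D). comp_map f j k x \<in> C}"
      using limit_space_eq_iff[OF cis lim k(2)] Csub k(1) by (fastforce simp: image_iff)
    moreover have "closedin (subtopology (X j) ?D) \<dots>"
      using cont C closedin_continuous_map_preimage by blast
    ultimately show ?thesis
      using D closedin_trans_full by fastforce
  qed
  moreover have "\<phi> i ` C \<subseteq> topspace L"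
    using lim Csub by (auto simp: limit_space_def)
  ultimately show "closedin L (\<phi> i ` C)"
    using fund by (simp add: fundamental_limit_space_def)
qed

text \<open>From \<open>n0\<close> on the iterated maps are identities on all of
  \<open>X n0\<close>, so the identification criterion makes \<open>\<phi> n\<close> agree with
  \<open>\<phi> n0\<close>.\<close>

lemma stationary_limit_space_topspace:
  assumes cis: "closed_injective_system X Y f" and lim: "limit_space X Y f L \<phi>"
    and stat: "\<And>n. n \<ge> n0 \<Longrightarrow>
      Y n = Y n0 \<and> Y n0 = topspace (X n0) \<and> X n = X n0 \<and> (\<forall>y\<in>Y n. f n y = y)"
  shows "topspace L = (\<Union>i\<in>{0..n0}. \<phi> i ` topspace (X i))"
proof -
  have comp: "comp_dom Y f n0 k = topspace (X n0) \<and> (\<forall>y\<in>topspace (X n0). comp_map f n0 k y = y)"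
    if "n0 \<le> k" for k
    using that
  proof (induction k rule: dec_induct)
    case base
    show ?case using stat[of n0] by simp
  next
    case (step k)
    then show ?case using stat[of "Suc k"] by auto
  qed
  have "\<phi> n ` topspace (X n) \<subseteq> (\<Union>i\<in>{0..n0}. \<phi> i ` topspace (X i))" for n
  proof (cases "n \<le> n0")
    case True
    then show ?thesis by auto
  next
    case False
    then obtain k where k: "n = Suc k" "n0 \<le> k"
      by (cases n) auto
    have "\<phi> n0 x = \<phi> n x" if "x \<in> topspace (X n)" for x
      using limit_space_eq_iff[OF cis lim k(2), of x x] comp[OF k(2)] stat[of n] k that by auto
    moreover have "topspace (X n) = topspace (X n0)"
      using stat[of n] k by auto
    ultimately have "\<phi> n ` topspace (X n) = \<phi> n0 ` topspace (X n0)"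
      by (metis image_cong)
    then show ?thesis by auto
  qed
  then show ?thesis
    using lim by (auto simp: limit_space_def)
qed

section \<open>Perfect maps from finite sums\<close>

text \<open>Finiteness of \<open>I\<close> enters twice: a finite union of closed images is closed,
  and a fibre is finite, having at most one point in each summand.\<close>

lemma perfect_map_finite_sum_topology:
  assumes fin: "finite I"
    and cont: "\<And>i. i \<in> I \<Longrightarrow> continuous_map (X i) L (\<phi> i)"
    and clo: "\<And>i. i \<in> I \<Longrightarrow> closed_map (X i) L (\<phi> i)"
    and inj: "\<And>i. i \<in> I \<Longrightarrow> inj_on (\<phi> i) (topspace (X i))"
    and top: "topspace L = (\<Union>i\<in>I. \<phi> i ` topspace (X i))"
  shows "perfect_map (sum_topology X I) L (\<lambda>(i, x). \<phi> i x)"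
proof -
  let ?g = "\<lambda>(i, x). \<phi> i x"
  have "continuous_map (sum_topology X I) L ?g"
    unfolding continuous_map
  proof (intro conjI allI impI)
    show "?g ` topspace (sum_topology X I) \<subseteq> topspace L"
      using top by auto
    fix U assume "openin L U"
    then have "openin (X i) {x \<in> topspace (X i). \<phi> i x \<in> U}" if "i \<in> I" for i
      using cont[OF that] openin_continuous_map_preimage by blast
    moreover have "{x \<in> topspace (sum_topology X I). ?g x \<in> U}
        = (SIGMA i:I. {x \<in> topspace (X i). \<phi> i x \<in> U})"
      by auto
    ultimately show "openin (sum_topology X I) {x \<in> topspace (sum_topology X I). ?g x \<in> U}"
      by (simp add: openin_disjoint_union)
  qed
  moreover have "closed_map (sum_topology X I) L ?g"
    unfolding closed_map_def
  proof (intro allI impI)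
    fix C assume "closedin (sum_topology X I) C"
    then obtain T where T: "C = Sigma I T" "\<And>i. i \<in> I \<Longrightarrow> closedin (X i) (T i)"
      by (auto simp: closedin_sum_topology_alt)
    then have "?g ` C = (\<Union>i\<in>I. \<phi> i ` T i)"
      by force
    moreover have "closedin L (\<Union>i\<in>I. \<phi> i ` T i)"
      using fin clo T(2) by (intro closedin_Union) (auto simp: closed_map_def)
    ultimately show "closedin L (?g ` C)" by simp
  qed
  moreover have "compactin (sum_topology X I) {z \<in> topspace (sum_topology X I). ?g z = y}" for y
  proof (rule finite_imp_compactin)
    have "inj_on fst {z \<in> topspace (sum_topology X I). ?g z = y}"
      using inj by (auto simp: inj_on_def)
    moreover have "fst ` {z \<in> topspace (sum_topology X I). ?g z = y} \<subseteq> I"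
      by auto
    ultimately show "finite {z \<in> topspace (sum_topology X I). ?g z = y}"
      using fin by (meson finite_imageD finite_subset)
  qed auto
  moreover have "?g ` topspace (sum_topology X I) = topspace L"
    unfolding top by force
  ultimately show ?thesis
    by (simp add: perfect_map_def proper_map_def)
qed

section \<open>Copying the sum into the universe, and conclusion\<close>

lemma inj_homeomorphic_copy:
  fixes h :: "'a \<Rightarrow> 'b" and S :: "'a topology"
  assumes "inj h"
  obtains W :: "'b topology" where "S homeomorphic_space W"
proof -
  \<comment> \<open>The topology of \<open>S\<close> is carried to \<open>range h\<close> along
    \<open>inv h\<close>, a left inverse of the injection \<open>h\<close>.\<close>
  define W where "W = pullback_topology (range h) (inv h) S"
  have "continuous_map W S (inv h)"
    using continuous_map_pullback[OF continuous_map_id, of "range h" "inv h" S]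
    by (simp add: W_def)
  moreover have "continuous_map S W h"
    unfolding W_def using assms by (intro continuous_map_pullback') (auto simp: comp_def)
  ultimately have "homeomorphic_maps S W h (inv h)"
    using assms by (auto simp: homeomorphic_maps_def W_def topspace_pullback_topology)
  then show thesis
    using that homeomorphic_space_def by blast
qed

text \<open>Cardinal arithmetic: the product of an infinite set with a nonempty set of no larger
  cardinality has the cardinality of the infinite set.\<close>

lemma infinite_inj_nat_times:
  includes cardinal_syntax
  assumes "infinite (UNIV :: 'u set)"
  obtains h :: "nat \<times> 'u \<Rightarrow> 'u" where "inj h"
proof -
  have "|UNIV :: nat set| \<le>o |UNIV :: 'u set|"
    using assms by (simp add: infinite_iff_card_of_nat)
  then obtain h :: "nat \<times> 'u \<Rightarrow> 'u" where "bij_betw h (UNIV \<times> UNIV) UNIV"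
    using card_of_Times_infinite[OF assms UNIV_not_empty] card_of_ordIso by blast
  then show thesis
    using that by (auto simp: bij_betw_def)
qed

theorem theorem11p10:
  fixes X :: "nat \<Rightarrow> 'u topology" and Y :: "nat \<Rightarrow> 'u set" and f :: "nat \<Rightarrow> 'u \<Rightarrow> 'u"
    and L :: "'u topology" and \<phi> :: "nat \<Rightarrow> 'u \<Rightarrow> 'u"
    and P :: "'u topology \<Rightarrow> bool"
  assumes "infinite (UNIV :: 'u set)"
    and "closed_injective_system X Y f"
    and "stationary_system X Y f"
    and "fundamental_limit_space X Y f L \<phi>"
    and "finite_perfect_property P"
    and "\<And>i. P (X i)"
  shows "P L"
proof -
  have lim: "limit_space X Y f L \<phi>"
    using assms(4) by (simp add: fundamental_limit_space_def)
  obtain n0 where "\<And>n. n \<ge> n0 \<Longrightarrow>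
      Y n = Y n0 \<and> Y n0 = topspace (X n0) \<and> X n = X n0 \<and> (\<forall>y\<in>Y n. f n y = y)"
    using assms(3) unfolding stationary_system_def by blast
  then have top: "topspace L = (\<Union>i\<in>{0..n0}. \<phi> i ` topspace (X i))"
    by (rule stationary_limit_space_topspace[OF assms(2) lim])
  let ?S = "sum_topology X {0..n0}"
  have perf: "perfect_map ?S L (\<lambda>(i, x). \<phi> i x)"
    using lim top fundamental_limit_space_closed_map[OF assms(2,4)] limit_space_maps_inj[OF lim]
    by (intro perfect_map_finite_sum_topology) (auto simp: limit_space_def)
  \<comment> \<open>\<open>P\<close> speaks only of spaces over \<open>'u\<close>, while
    \<open>?S\<close> lives on \<open>nat \<times> 'u\<close>; a homeomorphic copy \<open>W\<close>
    over \<open>'u\<close> stands in for it.\<close>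
  obtain h :: "nat \<times> 'u \<Rightarrow> 'u" where "inj h"
    using infinite_inj_nat_times[OF assms(1)] .
  then obtain W :: "'u topology" where "?S homeomorphic_space W"
    using inj_homeomorphic_copy[of h ?S] by blast
  then have W: "W homeomorphic_space ?S"
    using homeomorphic_space_sym by blast
  then have "P W"
    using assms(5,6) unfolding finite_perfect_property_def by blast
  moreover obtain k where "homeomorphic_map W ?S k"
    using W homeomorphic_space by blast
  then have "perfect_map W L ((\<lambda>(i, x). \<phi> i x) \<circ> k)"
    using perf homeomorphic_imp_perfect_map perfect_map_compose by blast
  ultimately show ?thesis
    using assms(5) unfolding finite_perfect_property_def perfect_property_def by blast
qed

end
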